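(* Let $K$ be a field, $\Gamma$ a group of automorphisms of $K$, and $\mathfrak{F}$ a $\Gamma$-invariant family of uniformly commensurable subfields of $K$. Suppose that at least one of the following holds: (a) the extension $FF'/F$ is separable for all $F,F'\in\mathfrak{F}$; or (b) $K$ has characteristic $p>0$ and the Eršov invariant $[F:F^p]$ is finite for every $F\in\mathfrak{F}$. Then there is a $\Gamma$-invariant subfield $N$ of $K$ which is commensurable with $\mathfrak{F}$ (i.e. commensurable with every $F\in\mathfrak{F}$).
   Context: For two subfields $F,F'$ of $K$, $FF'$ denotes their compositum in $K$. $F$ is commensurably contained in $F'$ if the degree $[FF':F']$ is finite; $F$ and $F'$ are commensurable if each is commensurably contained in the other, i.e. both $[FF':F]$ and $[FF':F']$ are finite. A family $\mathfrak{F}$ of subfields is uniformly commensurable if there is a natural number $n$ such that $[FF':F]\le n$ for all $F,F'\in\mathfrak{F}$. The family $\mathfrak{F}$ is $\Gamma$-invariant if $\gamma F\in\mathfrak{F}$ for all $F\in\mathfrak{F}$, $\gamma\in\Gamma$; a subfield $N$ is $\Gamma$-invariant if $\gamma N=N$ for all $\gamma\in\Gamma$. In characteristic $p>0$, $F^p=\{x^p:x\in F\}$. *)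

theory Defs
  imports "HOL-Algebra.Algebra"
begin

definition compositum :: "('a, 'b) ring_scheme \<Rightarrow> 'a set \<Rightarrow> 'a set \<Rightarrow> 'a set" where
  "compositum K F F' = generate_field K (F \<union> F')"

definition commensurably_contained :: "('a, 'b) ring_scheme \<Rightarrow> 'a set \<Rightarrow> 'a set \<Rightarrow> bool" where
  "commensurably_contained K F F' \<longleftrightarrow> ring.finite_dimension K F' (compositum K F F')"

definition commensurable :: "('a, 'b) ring_scheme \<Rightarrow> 'a set \<Rightarrow> 'a set \<Rightarrow> bool" where
  "commensurable K F F' \<longleftrightarrow>
     commensurably_contained K F F' \<and> commensurably_contained K F' F"

(* ring.dim is meaningless for an infinite extension, hence the explicit finiteness conjunct. *)
definition uniformly_commensurable :: "('a, 'b) ring_scheme \<Rightarrow> 'a set set \<Rightarrow> bool" where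
  "uniformly_commensurable K \<FF> \<longleftrightarrow>
     (\<exists>n::nat. \<forall>F\<in>\<FF>. \<forall>F'\<in>\<FF>.
        ring.finite_dimension K F (compositum K F F') \<and>
        ring.dim K F (compositum K F F') \<le> n)"

definition invariant_family :: "('a \<Rightarrow> 'a) set \<Rightarrow> 'a set set \<Rightarrow> bool" where
  "invariant_family \<Gamma> \<FF> \<longleftrightarrow> (\<forall>\<gamma>\<in>\<Gamma>. \<forall>F\<in>\<FF>. \<gamma> ` F \<in> \<FF>)"

definition invariant_set :: "('a \<Rightarrow> 'a) set \<Rightarrow> 'a set \<Rightarrow> bool" where
  "invariant_set \<Gamma> N \<longleftrightarrow> (\<forall>\<gamma>\<in>\<Gamma>. \<gamma> ` N = N)"

(* Elements of BijGroup are extensional functions on the carrier, so that distinct members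
   of \<Gamma> are distinct as automorphisms of K. *)
definition automorphism_group :: "('a, 'b) ring_scheme \<Rightarrow> ('a \<Rightarrow> 'a) set \<Rightarrow> bool" where
  "automorphism_group K \<Gamma> \<longleftrightarrow> subgroup \<Gamma> (BijGroup (carrier K)) \<and> \<Gamma> \<subseteq> ring_iso K K"

(* A polynomial over K is separable if all its roots in an algebraic closure of K are simple;
   indexed_const embeds K into the library's algebraic closure. *)
definition separable_polynomial :: "('a, 'b) ring_scheme \<Rightarrow> 'a list \<Rightarrow> bool" where
  "separable_polynomial K p \<longleftrightarrow> p \<noteq> [] \<and>
     (\<forall>a \<in> carrier (field.alg_closure K).
        ring.alg_mult (field.alg_closure K) (map (ring.indexed_const K) p) a \<le> 1)"

(* Separability of an algebraic extension E/F inside K. Under uniform commensurability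
   all the extensions FF'/F are finite, hence algebraic. *)
definition separable_extension :: "('a, 'b) ring_scheme \<Rightarrow> 'a set \<Rightarrow> 'a set \<Rightarrow> bool" where
  "separable_extension K F E \<longleftrightarrow>
     (\<forall>x\<in>E. ring.algebraic K F x \<and> separable_polynomial K (ring.Irr K F x))"

(* The analogue for records of the type-class constant CHAR. *)
definition characteristic :: "('a, 'b) ring_scheme \<Rightarrow> nat" where
  "characteristic K = Gcd {n::nat. [n] \<cdot>\<^bsub>K\<^esub> \<one>\<^bsub>K\<^esub> = \<zero>\<^bsub>K\<^esub>}"

definition power_image :: "('a, 'b) ring_scheme \<Rightarrow> nat \<Rightarrow> 'a set \<Rightarrow> 'a set" where
  "power_image K p F = (\<lambda>x. x [^]\<^bsub>K\<^esub> p) ` F"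

end

theory Submission
  imports Defs
begin

text \<open>The intersection of two commensurable subfields may be far too small to be commensurable with
  them, so an invariant subfield cannot be obtained by intersecting members of the family. The proof
  passes to composita, which behave well, and then descends from a large compositum to a canonical
  smaller field.

  Call a subfield \<open>C\<close> bounding if it contains a member of the family and the degrees \<open>[CF : F]\<close>, for
  \<open>F\<close> in the family, are bounded. Bounding fields are closed under composita. For a bounding \<open>C\<close> the
  degrees \<open>[CF : C]\<close> are bounded too, and they can only drop when \<open>C\<close> grows. Let \<open>m\<close> be the least
  value of their maximum, call \<open>C\<close> saturated if it attains this value, and call \<open>F\<close> generic over
  \<open>C\<close> if \<open>[CF : C] = m\<close>. If \<open>C \<subseteq> C'\<close> are saturated and \<open>F\<close> is generic over \<open>C'\<close>, then \<open>F\<close> is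
  generic over \<open>C\<close>, and \<open>CF\<close> and \<open>C'\<close> are linearly disjoint over \<open>C\<close>.

  The key point (\<open>descent_base_is_descent_field\<close>) is that among the subfields \<open>D\<close> of \<open>C\<close> with
  \<open>[DF : D] = m\<close> there is a least one. Choose a basis of \<open>CF\<close> over \<open>C\<close> inside \<open>F\<close>. A field \<open>D\<close>
  qualifies exactly if it contains the coordinates of all elements of \<open>F\<close>, so the field
  generated by these coordinates is the smallest possibility. This least field \<open>D\<close> plays the role
  of an intersection of \<open>C\<close> and \<open>F\<close>. It does not change when \<open>C\<close> is replaced by a larger field
  over which \<open>F\<close> is still generic (\<open>descent_base_eq\<close>), and comparing degrees in the square
  \<open>D, C, DF, CF\<close> gives \<open>[C : D] = [CF : DF] \<le> [CF : F]\<close> (\<open>degree_over_descent_field\<close>).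

  Let the core of \<open>C\<close> be generated by these least fields for all \<open>F\<close> generic over \<open>C\<close>. A
  larger \<open>C'\<close> has fewer generic members, so its core is contained in the core of \<open>C\<close>; but the degree
  of \<open>C\<close> over the core of \<open>C'\<close> stays bounded independently of \<open>C'\<close>. Hence the core is constant from
  some saturated \<open>C\<close> on (\<open>core_stabilises\<close>). For an automorphism \<open>h\<close> preserving the family, the core
  of the compositum of \<open>C\<close> and \<open>h C\<close> is then both the core of \<open>C\<close> and a subfield of the core of
  \<open>h C\<close>, which is the image of the core of \<open>C\<close>. Applying this to \<open>h\<close> and its inverse shows that the
  core of \<open>C\<close> is invariant. It is commensurable with the family, as it lies between a least field
  \<open>D\<close> and the bounding field \<open>C\<close>.\<close>

section \<open>Degrees of composita\<close>

context field
begin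

lemma compositum_subfield:
  assumes "subfield C R" "subfield F R"
  shows "subfield (compositum R C F) R"
  unfolding compositum_def
  using assms[THEN subfieldE(3)] by (intro generate_field_is_subfield) blast

lemma compositum_upper:
  shows "C \<subseteq> compositum R C F" "F \<subseteq> compositum R C F"
  unfolding compositum_def by (auto intro: generate_field.incl)

lemma compositum_least:
  assumes "subfield E R" "C \<subseteq> E" "F \<subseteq> E"
  shows "compositum R C F \<subseteq> E"
  unfolding compositum_def
  using assms subfieldE(3)[OF assms(1)] by (intro generate_field_min_subfield1) blast+

lemma compositum_commute: "compositum R C F = compositum R F C"
  unfolding compositum_def by (simp add: Un_commute)

lemma compositum_absorb:
  assumes "subfield E R" "C \<subseteq> E"
  shows "compositum R C E = E"
  using compositum_least[OF assms subset_refl] compositum_upper(2) by (rule subset_antisym)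

lemma compositum_mono:
  assumes "subfield C' R" "subfield F R" "C \<subseteq> C'"
  shows "compositum R C F \<subseteq> compositum R C' F"
  using subset_trans[OF assms(3) compositum_upper(1)] compositum_upper(2)
  by (rule compositum_least[OF compositum_subfield[OF assms(1,2)]])

lemma compositum_right_commute:
  assumes "subfield C R" "subfield D R" "subfield F R"
  shows "compositum R (compositum R C F) D = compositum R (compositum R C D) F"
proof -
  have "compositum R (compositum R C A) B \<subseteq> compositum R (compositum R C B) A"
    if "subfield A R" "subfield B R" for A B
  proof -
    have C_B: "subfield (compositum R C B) R" by (rule compositum_subfield[OF assms(1) that(2)])
    have "compositum R C A \<subseteq> compositum R (compositum R C B) A"
      by (rule compositum_mono[OF C_B that(1) compositum_upper(1)])
    moreover have "B \<subseteq> compositum R (compositum R C B) A"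
      by (rule subset_trans[OF compositum_upper(2) compositum_upper(1)])
    ultimately show ?thesis by (rule compositum_least[OF compositum_subfield[OF C_B that(1)]])
  qed
  thus ?thesis using assms(2,3) by (intro subset_antisym)
qed

lemma Span_scalars_mono:
  assumes "subfield D R" "subfield C R" "D \<subseteq> C" "set Us \<subseteq> carrier R"
  shows "Span D Us \<subseteq> Span C Us"
  using Span_eq_combine_set[OF assms(1,4)] Span_eq_combine_set[OF assms(2,4)] assms(3) by blast

lemma independent_scalars_antimono:
  assumes "subfield D R" "subfield C R" "D \<subseteq> C" "independent C Us"
  shows "independent D Us"
  using assms(4)
proof (induction Us rule: list.induct)
  case (Cons u Us)
  hence *: "u \<in> carrier R" "u \<notin> Span C Us" "independent C Us"
    using independent_backwards[OF Cons.prems] independent_in_carrier[OF Cons.prems] by auto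
  moreover have "u \<notin> Span D Us"
    using Span_scalars_mono[OF assms(1-3) independent_in_carrier[OF *(3)]] *(2) by blast
  ultimately show ?case using Cons.IH by (intro independent.li_Cons) auto
qed simp

text \<open>Every element of the ring is algebraic over the base, so its inverse is a polynomial in it.\<close>

lemma finite_dimension_subring_is_subfield:
  assumes "subfield C R" "subring E R" "C \<subseteq> E" "finite_dimension C E"
  shows "subfield E R"
proof (rule subfieldI'[OF assms(2)])
  fix x assume x: "x \<in> E - {\<zero>}"
  hence xc: "x \<in> carrier R" using subringE(1)[OF assms(2)] by auto
  have "(algebraic over C) x"
    using finite_dimension_imp_algebraic[OF assms(1,2,4)] x by auto
  hence "subfield (simple_extension C x) R"
    using simple_extension_is_subfield[OF assms(1) xc] by simp
  moreover have "x \<in> simple_extension C x"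
    using simple_extension_mem[OF subfieldE(1)[OF assms(1)] xc] .
  ultimately have "inv x \<in> simple_extension C x"
    using subfield_m_inv(1) x by blast
  moreover have "simple_extension C x \<subseteq> E"
    using simple_extension_subring_incl[OF assms(2,3)] x by blast
  ultimately show "inv x \<in> E" by blast
qed

lemma subalgebra_subfield:
  assumes "subfield E R" "C \<subseteq> E"
  shows "subalgebra C E R"
  using subring.axioms(1)[OF subfieldE(1)[OF assms(1)]] subringE(6)[OF subfieldE(1)[OF assms(1)]]
    assms(2)
  by (intro subalgebra.intro subalgebra_axioms.intro) auto

text \<open>Bases of a compositum can be chosen in one of the factors. The reason is that the span is closed
  under multiplication, since products of the spanning elements lie in \<open>F\<close> and hence in the span again;
  a ring of finite dimension over \<open>C\<close> is then a field.\<close>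

lemma Span_eq_compositum:
  assumes C: "subfield C R" and F: "subfield F R"
    and Us: "set Us \<subseteq> F" and cover: "F \<subseteq> Span C Us"
  shows "Span C Us = compositum R C F"
proof -
  define S where "S = Span C Us"
  have Uc: "set Us \<subseteq> carrier R" using Us subfieldE(3)[OF F] by blast
  note S = Span_subgroup_props[OF C Uc, folded S_def]
  note S_smult = Span_smult_closed[OF C Uc, folded S_def]
  note Us_S = Span_base_incl[OF C Uc, folded S_def]
  note S_least = subalgebra_Span_incl[OF C, of _ Us, folded S_def]
  note F_S = cover[folded S_def]
  \<comment> \<open>The elements that \<open>w\<close> multiplies into the span form a subspace, so it suffices to test the
    spanning list. This is used first for \<open>w\<close> in \<open>F\<close> and then for arbitrary \<open>w\<close> in the span.\<close>
  have sub_if: "v \<otimes> w \<in> S"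
    if w: "w \<in> carrier R" and U: "\<And>u. u \<in> set Us \<Longrightarrow> u \<otimes> w \<in> S" and v: "v \<in> S" for v w
  proof -
    let ?T = "{v \<in> S. v \<otimes> w \<in> S}"
    have "subgroup ?T (add_monoid R)"
    proof (rule add.subgroupI)
      show "?T \<subseteq> carrier R" using S(1) by blast
      have "\<zero> \<in> ?T" using S(2) w by simp
      thus "?T \<noteq> {}" by blast
    next
      fix a assume a: "a \<in> ?T"
      hence "a \<in> carrier R" using S(1) by blast
      hence "\<ominus> a \<otimes> w = \<ominus> (a \<otimes> w)" using w l_minus by blast
      thus "\<ominus> a \<in> ?T" using a S(4) by simp
    next
      fix a b assume ab: "a \<in> ?T" "b \<in> ?T"
      hence "a \<in> carrier R" "b \<in> carrier R" using S(1) by blast+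
      hence "(a \<oplus> b) \<otimes> w = a \<otimes> w \<oplus> b \<otimes> w" using w l_distr by blast
      thus "a \<oplus> b \<in> ?T" using ab S(3) by simp
    qed
    moreover have "subalgebra_axioms C ?T R"
    proof
      fix k v assume kv: "k \<in> C" "v \<in> ?T"
      hence "k \<in> carrier R" "v \<in> carrier R" using S(1) subfieldE(3)[OF C] by blast+
      hence "k \<otimes> v \<otimes> w = k \<otimes> (v \<otimes> w)" using w m_assoc by blast
      thus "k \<otimes> v \<in> ?T" using kv S_smult by simp
    qed
    ultimately have "subalgebra C ?T R" by (rule subalgebra.intro)
    moreover have "set Us \<subseteq> ?T" using U Us_S by blast
    ultimately have "S \<subseteq> ?T" by (rule S_least)
    thus ?thesis using v by blast
  qed
  have F_mult: "v \<otimes> f \<in> S" if "v \<in> S" "f \<in> F" for v f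
  proof -
    have "u \<otimes> f \<in> S" if "u \<in> set Us" for u
      using that \<open>f \<in> F\<close> Us F_S subringE(6)[OF subfieldE(1)[OF F]] by blast
    thus ?thesis using sub_if[of f v] that subfieldE(3)[OF F] by blast
  qed
  have mult: "v \<otimes> w \<in> S" if "v \<in> S" "w \<in> S" for v w
  proof -
    have "u \<otimes> w \<in> S" if "u \<in> set Us" for u
      using F_mult[OF \<open>w \<in> S\<close>, of u] that Us Uc S(1) \<open>w \<in> S\<close> m_comm[of u w]
      by (metis subsetD)
    thus ?thesis using sub_if[of w v] that S(1) by blast
  qed
  have one: "\<one> \<in> S" using F_S subringE(3)[OF subfieldE(1)[OF F]] by blast
  have "subring S R"
    using S mult one by (intro subringI) auto
  moreover have CS: "C \<subseteq> S"
  proof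
    fix c assume "c \<in> C"
    hence "c \<otimes> \<one> \<in> S" "c \<in> carrier R"
      using S_smult one subfieldE(3)[OF C] by blast+
    thus "c \<in> S" by simp
  qed
  ultimately have "subfield S R"
    using finite_dimension_subring_is_subfield[OF C] Span_finite_dimension[OF C Uc] S_def by blast
  hence "compositum R C F \<subseteq> S" using compositum_least CS F_S by blast
  moreover have "S \<subseteq> compositum R C F"
  proof (rule S_least)
    note E = compositum_subfield[OF C F]
    show "set Us \<subseteq> compositum R C F" using Us compositum_upper by blast
    show "subalgebra C (compositum R C F) R"
      using subalgebra_subfield[OF E compositum_upper(1)] .
  qed
  ultimately show ?thesis unfolding S_def by blast
qed

text \<open>A longest independent list in \<open>F\<close> spans \<open>F\<close>, hence the compositum.\<close>

lemma compositum_basis: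
  assumes C: "subfield C R" and F: "subfield F R"
    and dim: "dimension n C (compositum R C F)"
  obtains Us where "set Us \<subseteq> F" "independent C Us" "length Us = n" "Span C Us = compositum R C F"
proof -
  define P where "P = (\<lambda>k. \<exists>Us. set Us \<subseteq> F \<and> independent C Us \<and> length Us = k)"
  have bound: "\<forall>k. P k \<longrightarrow> k \<le> n"
    using independent_length_le_dimension[OF C dim] compositum_upper(2)
    unfolding P_def by blast
  have "P 0" unfolding P_def by auto
  hence "P (Greatest P)" and greatest: "\<And>k. P k \<Longrightarrow> k \<le> Greatest P"
    using GreatestI_nat[of P 0 n] Greatest_le_nat[of P _ n] bound by blast+
  then obtain Us where Us: "set Us \<subseteq> F" "independent C Us" "length Us = Greatest P"
    unfolding P_def by blast
  have "F \<subseteq> Span C Us"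
  proof
    fix f assume f: "f \<in> F"
    show "f \<in> Span C Us"
    proof (rule ccontr)
      assume "f \<notin> Span C Us"
      hence "independent C (f # Us)"
        using Us(2) f subfieldE(3)[OF F] by (intro independent.li_Cons) auto
      hence "P (Suc (Greatest P))" using Us f unfolding P_def
        by (intro exI[of _ "f # Us"]) auto
      from greatest[OF this] show False by simp
    qed
  qed
  hence "Span C Us = compositum R C F" using Span_eq_compositum[OF C F Us(1)] by blast
  moreover from this have "length Us = n"
    using independent_length_eq_dimension[OF C dim Us(2)] Us(1) compositum_upper(2) by blast
  ultimately show ?thesis using that Us by blast
qed

text \<open>The existential form makes finiteness part of the bound; the number \<open>dim C E\<close> alone carries no
  information for an infinite extension.\<close>

definition degree_at_most :: "nat \<Rightarrow> 'a set \<Rightarrow> 'a set \<Rightarrow> bool" where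
  "degree_at_most n C E \<longleftrightarrow> (\<exists>k\<le>n. dimension k C E)"

lemma degree_at_most_subfield:
  assumes C: "subfield C R" and V: "subfield V R" and "C \<subseteq> V" "V \<subseteq> E"
    and "degree_at_most n C E"
  shows "degree_at_most n C V"
proof -
  obtain k where k: "k \<le> n" "dimension k C E"
    using assms(5) unfolding degree_at_most_def by blast
  have "finite_dimension C V"
    using subalbegra_incl_imp_finite_dimension[OF C finite_dimensionI[OF k(2)]
        subalgebra_subfield[OF V assms(3)] assms(4)] .
  then obtain j where j: "dimension j C V" by auto
  then obtain Vs where "independent C Vs" "length Vs = j" "Span C Vs = V" "set Vs \<subseteq> V"
    using exists_base[OF C j] Span_base_incl[OF C] by blast
  hence "j \<le> k" using independent_length_le_dimension[OF C k(2)] assms(4) by blast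
  thus ?thesis using j k unfolding degree_at_most_def by (meson le_trans)
qed

text \<open>Enlarging the base does not increase the degree of a compositum: a basis over the larger field
  can be chosen inside \<open>E\<close>, and it is still independent over the smaller one.\<close>

lemma degree_at_most_compositum:
  assumes D: "subfield D R" and C: "subfield C R" and E: "subfield E R" and DC: "D \<subseteq> C"
    and deg: "degree_at_most n D (compositum R D E)"
  shows "degree_at_most n C (compositum R C E)"
proof -
  obtain k where k: "k \<le> n" "dimension k D (compositum R D E)"
    using deg unfolding degree_at_most_def by blast
  obtain Us where Us: "set Us \<subseteq> E" "Span D Us = compositum R D E"
    using compositum_basis[OF D E k(2)] by metis
  have Uc: "set Us \<subseteq> carrier R" using Us(1) subfieldE(3)[OF E] by blast
  have "E \<subseteq> Span C Us"
    using Span_scalars_mono[OF D C DC Uc] Us(2) compositum_upper(2) by blast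
  hence "Span C Us = compositum R C E" by (rule Span_eq_compositum[OF C E Us(1)])
  hence "finite_dimension C (compositum R C E)"
    using Span_finite_dimension[OF C Uc] by simp
  then obtain j where j: "dimension j C (compositum R C E)" by auto
  obtain Vs where Vs: "set Vs \<subseteq> E" "independent C Vs" "length Vs = j"
    using compositum_basis[OF C E j] by metis
  have "j \<le> k"
    using independent_length_le_dimension[OF D k(2) independent_scalars_antimono[OF D C DC Vs(2)]]
      Vs compositum_upper(2) by blast
  thus ?thesis using j k unfolding degree_at_most_def by (meson le_trans)
qed

lemma degree_at_most_upper:
  assumes "subfield D R" "subfield C R" "subfield E R" "D \<subseteq> C" "C \<subseteq> E"
    and "degree_at_most n D E"
  shows "degree_at_most n C E"
proof -
  have "D \<subseteq> E" using assms(4,5) by blast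
  thus ?thesis
    using degree_at_most_compositum[OF assms(1-4)] assms(3,5,6) compositum_absorb by simp
qed

lemma degree_at_most_tower:
  assumes "subfield C R" "subfield D R" "degree_at_most a C D" "degree_at_most b D E"
  shows "degree_at_most (a * b) C E"
  using assms(3,4) telescopic_base[OF assms(1,2)] mult_le_mono
  unfolding degree_at_most_def by metis

lemma degree_at_most_imp_finite: "degree_at_most n C E \<Longrightarrow> finite_dimension C E"
  unfolding degree_at_most_def finite_dimension_def by blast

lemma dimension_pos:
  assumes "dimension n C E" "subfield E R"
  shows "0 < n"
  using assms dimension_zero[of C E] subringE(3)[OF subfieldE(1)[OF assms(2)]]
  by (cases n) auto

lemma eq_if_same_dimension:
  assumes C: "subfield C R" and "dimension n C V" "dimension n C E" "V \<subseteq> E"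
  shows "V = E"
proof -
  obtain Vs where Vs: "set Vs \<subseteq> carrier R" "independent C Vs" "length Vs = n" "Span C Vs = V"
    using exists_base[OF C assms(2)] by blast
  hence "set Vs \<subseteq> E" using Span_base_incl[OF C] assms(4) by blast
  thus ?thesis using independent_length_eq_dimension[OF C assms(3) Vs(2)] Vs by blast
qed


section \<open>Fields of definition of a generic extension\<close>

text \<open>These fields will be considered for \<open>m = [CF : C]\<close>. In this case, a subfield \<open>D\<close> of \<open>C\<close> belongs to
  \<open>descent_fields m C F\<close> if and only if \<open>DF\<close> and \<open>C\<close> are linearly disjoint over \<open>D\<close>, that is, if the
  extension \<open>CF\<close> of \<open>C\<close> is obtained from \<open>DF\<close> by base change.\<close>

definition descent_fields :: "nat \<Rightarrow> 'a set \<Rightarrow> 'a set \<Rightarrow> 'a set set" where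
  "descent_fields m C F = {D. subfield D R \<and> D \<subseteq> C \<and> dimension m D (compositum R D F)}"

definition descent_base :: "nat \<Rightarrow> 'a set \<Rightarrow> 'a set \<Rightarrow> 'a set" where
  "descent_base m C F = \<Inter> (descent_fields m C F)"

text \<open>Fix a basis of \<open>CF\<close> over \<open>C\<close> that lies in \<open>F\<close>. It is a basis of \<open>DF\<close> over every descent field
  \<open>D\<close>, so that the coordinates of an element of \<open>F\<close>, which are unique over \<open>C\<close>, lie in all
  descent fields and therefore in their intersection.\<close>

lemma descent_base_is_descent_field:
  assumes C: "subfield C R" and F: "subfield F R" and dim: "dimension m C (compositum R C F)"
  shows "descent_base m C F \<in> descent_fields m C F"
proof -
  let ?B = "descent_base m C F"
  obtain Us where Us: "set Us \<subseteq> F" "independent C Us" "length Us = m"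
      "Span C Us = compositum R C F"
    using compositum_basis[OF C F dim] by metis
  have Uc: "set Us \<subseteq> carrier R" using Us(1) subfieldE(3)[OF F] by blast
  have C_in: "C \<in> descent_fields m C F" unfolding descent_fields_def using C dim by blast
  have B_sub: "subfield ?B R"
  proof (rule subfieldI')
    show "subring ?B R"
      unfolding descent_base_def using C_in
      by (intro subring_Inter) (auto simp: descent_fields_def intro: subfieldE(1))
    show "inv k \<in> ?B" if "k \<in> ?B - {\<zero>}" for k
      using that subfield_m_inv(1) unfolding descent_base_def descent_fields_def by blast
  qed
  have BC: "?B \<subseteq> C" unfolding descent_base_def using C_in by blast
  have "F \<subseteq> Span ?B Us"
  proof
    fix f assume f: "f \<in> F"
    have cover: "f \<in> Span D Us" if "D \<in> descent_fields m C F" for D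
    proof -
      have D: "subfield D R" "D \<subseteq> C" "dimension m D (compositum R D F)"
        using that unfolding descent_fields_def by blast+
      have "Span D Us = compositum R D F"
        using independent_length_eq_dimension[OF D(1,3) independent_scalars_antimono[OF D(1) C D(2) Us(2)]]
          Us(1,3) compositum_upper(2)[of F D] by blast
      thus ?thesis using f compositum_upper(2) by blast
    qed
    have fC: "f \<in> Span C Us" by (rule cover[OF C_in])
    then obtain Ks where Ks: "set Ks \<subseteq> C" "length Ks = length Us" "f = combine Ks Us"
      using Span_mem_iff_length_version[OF C Uc] by blast
    have "set Ks \<subseteq> D" if D: "D \<in> descent_fields m C F" for D
    proof -
      have DC: "subfield D R" "D \<subseteq> C" using D unfolding descent_fields_def by blast+
      obtain Ls where Ls: "set Ls \<subseteq> D" "length Ls = length Us" "f = combine Ls Us"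
        using cover[OF D] Span_mem_iff_length_version[OF DC(1) Uc] by blast
      have "Ls = Ks"
        using unique_decomposition[OF C Us(2) fC] Ks Ls subset_trans[OF Ls(1) DC(2)] by blast
      thus ?thesis using Ls(1) by blast
    qed
    hence "set Ks \<subseteq> ?B" unfolding descent_base_def by blast
    thus "f \<in> Span ?B Us" using Span_mem_iff_length_version[OF B_sub Uc] Ks by blast
  qed
  hence "Span ?B Us = compositum R ?B F" by (rule Span_eq_compositum[OF B_sub F Us(1)])
  hence "dimension m ?B (compositum R ?B F)"
    using dimensionI[OF B_sub independent_scalars_antimono[OF B_sub C BC Us(2)]] Us(3) by blast
  thus ?thesis unfolding descent_fields_def using B_sub BC by blast
qed

text \<open>The smaller field \<open>C\<close> is itself a descent field over \<open>C'\<close>, so the least descent field over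
  \<open>C'\<close> already lies in \<open>C\<close>.\<close>

lemma descent_base_eq:
  assumes C: "subfield C R" and C': "subfield C' R" and F: "subfield F R" and "C \<subseteq> C'"
    and dim: "dimension m C (compositum R C F)" and dim': "dimension m C' (compositum R C' F)"
  shows "descent_base m C' F = descent_base m C F"
proof
  have sub: "descent_fields m C F \<subseteq> descent_fields m C' F"
    using \<open>C \<subseteq> C'\<close> unfolding descent_fields_def by blast
  thus "descent_base m C' F \<subseteq> descent_base m C F" unfolding descent_base_def by blast
  have "C \<in> descent_fields m C' F"
    using C \<open>C \<subseteq> C'\<close> dim unfolding descent_fields_def by blast
  hence "descent_base m C' F \<subseteq> C" unfolding descent_base_def by blast
  hence "descent_base m C' F \<in> descent_fields m C F"
    using descent_base_is_descent_field[OF C' F dim'] unfolding descent_fields_def by blast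
  thus "descent_base m C F \<subseteq> descent_base m C' F" unfolding descent_base_def[of m C F] by blast
qed

text \<open>Computing \<open>[CF : D]\<close> through \<open>C\<close> and through \<open>DF\<close> gives \<open>[C : D] m = m [CF : DF]\<close>, and
  \<open>DF\<close> contains \<open>F\<close>.\<close>

lemma degree_over_descent_field:
  assumes C: "subfield C R" and F: "subfield F R" and dim: "dimension m C (compositum R C F)"
    and D: "D \<in> descent_fields m C F" and deg: "degree_at_most b F (compositum R C F)"
  shows "degree_at_most b D C"
proof -
  have D_sub: "subfield D R" and DC: "D \<subseteq> C" and D_dim: "dimension m D (compositum R D F)"
    using D unfolding descent_fields_def by blast+
  note CF = compositum_subfield[OF C F] and DF = compositum_subfield[OF D_sub F]
  have "degree_at_most b (compositum R D F) (compositum R C F)"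
    by (rule degree_at_most_upper[OF F DF CF compositum_upper(2) compositum_mono[OF C F DC] deg])
  then obtain a where a: "a \<le> b" "dimension a (compositum R D F) (compositum R C F)"
    unfolding degree_at_most_def by blast
  have total: "dimension (m * a) D (compositum R C F)"
    by (rule telescopic_base[OF D_sub DF D_dim a(2)])
  hence "degree_at_most (m * a) D C"
    using degree_at_most_subfield[OF D_sub C DC compositum_upper(1)]
    unfolding degree_at_most_def by blast
  then obtain c where c: "dimension c D C" unfolding degree_at_most_def by blast
  have "c * m = m * a"
    by (rule dimension_is_inj[OF D_sub telescopic_base[OF D_sub C c dim] total])
  hence "c = a" using dimension_pos[OF dim CF] by simp
  thus ?thesis using a(1) c unfolding degree_at_most_def by blast
qed

section \<open>Images under automorphisms\<close>

lemma ring_iso_image_subfield: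
  assumes "h \<in> ring_iso R R" "subfield C R"
  shows "subfield (h ` C) R"
proof -
  interpret h: ring_hom_ring R R h
    using assms(1) ring_axioms by (auto intro!: ring_hom_ringI2 simp: ring_iso_def)
  show ?thesis using h.img_is_subfield(2)[OF assms(2)] by simp
qed

lemma ring_iso_image_dimension:
  assumes "h \<in> ring_iso R R" "subfield C R" "dimension n C E"
  shows "dimension n (h ` C) (h ` E)"
proof -
  interpret h: ring_hom_ring R R h
    using assms(1) ring_axioms by (auto intro!: ring_hom_ringI2 simp: ring_iso_def)
  have "E \<subseteq> carrier R" using space_subgroup_props(1)[OF assms(2,3)] .
  hence "inj_on h E"
    using ring_iso_memE(5)[OF assms(1)] unfolding bij_betw_def by (blast intro: inj_on_subset)
  thus ?thesis using h.inj_hom_dimension[OF assms(2)] assms(3) by simp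
qed

lemma ring_iso_inverse:
  assumes h: "h \<in> ring_iso R R"
  shows "inv_into (carrier R) h \<in> ring_iso R R"
    and "A \<subseteq> carrier R \<Longrightarrow> inv_into (carrier R) h ` h ` A = A"
    and "A \<subseteq> carrier R \<Longrightarrow> h ` inv_into (carrier R) h ` A = A"
proof -
  have inj: "inj_on h (carrier R)" and surj: "h ` carrier R = carrier R"
    using ring_iso_memE(5)[OF h] unfolding bij_betw_def by blast+
  show "inv_into (carrier R) h \<in> ring_iso R R" by (rule ring_iso_set_sym[OF ring_axioms h])
  show "inv_into (carrier R) h ` h ` A = A" if "A \<subseteq> carrier R"
    using inv_into_image_cancel[OF inj that] .
  show "h ` inv_into (carrier R) h ` A = A" if "A \<subseteq> carrier R"
    using image_inv_into_cancel[OF surj that] .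
qed

lemma ring_iso_image_compositum:
  assumes h: "h \<in> ring_iso R R" and C: "subfield C R" and F: "subfield F R"
  shows "h ` compositum R C F = compositum R (h ` C) (h ` F)"
proof
  let ?g = "inv_into (carrier R) h"
  note hC = ring_iso_image_subfield[OF h C] and hF = ring_iso_image_subfield[OF h F]
  note hCF = compositum_subfield[OF hC hF] and CF = compositum_subfield[OF C F]
  show "compositum R (h ` C) (h ` F) \<subseteq> h ` compositum R C F"
    using compositum_upper[of C F] compositum_upper[of F C]
    by (intro compositum_least[OF ring_iso_image_subfield[OF h CF]] image_mono)
  have "?g ` h ` C \<subseteq> ?g ` compositum R (h ` C) (h ` F)"
    "?g ` h ` F \<subseteq> ?g ` compositum R (h ` C) (h ` F)"
    by (intro image_mono compositum_upper)+
  hence "C \<subseteq> ?g ` compositum R (h ` C) (h ` F)" "F \<subseteq> ?g ` compositum R (h ` C) (h ` F)"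
    using ring_iso_inverse(2)[OF h] subfieldE(3)[OF C] subfieldE(3)[OF F] by auto
  hence "compositum R C F \<subseteq> ?g ` compositum R (h ` C) (h ` F)"
    by (rule compositum_least[OF ring_iso_image_subfield[OF ring_iso_inverse(1)[OF h] hCF]])
  hence "h ` compositum R C F \<subseteq> h ` ?g ` compositum R (h ` C) (h ` F)" by (rule image_mono)
  thus "h ` compositum R C F \<subseteq> compositum R (h ` C) (h ` F)"
    using ring_iso_inverse(3)[OF h subfieldE(3)[OF hCF]] by simp
qed

lemma ring_iso_image_degree_at_most:
  assumes h: "h \<in> ring_iso R R" and C: "subfield C R" and F: "subfield F R"
    and E: "subfield E R" and deg: "degree_at_most b E (compositum R C F)"
  shows "degree_at_most b (h ` E) (compositum R (h ` C) (h ` F))"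
  using deg ring_iso_image_dimension[OF h E] ring_iso_image_compositum[OF h C F]
  unfolding degree_at_most_def by metis

lemma ring_iso_image_descent_field:
  assumes h: "h \<in> ring_iso R R" and F: "subfield F R" and D: "D \<in> descent_fields m C F"
  shows "h ` D \<in> descent_fields m (h ` C) (h ` F)"
proof -
  have *: "subfield D R" "D \<subseteq> C" "dimension m D (compositum R D F)"
    using D unfolding descent_fields_def by blast+
  have "dimension m (h ` D) (compositum R (h ` D) (h ` F))"
    using ring_iso_image_dimension[OF h *(1,3)] ring_iso_image_compositum[OF h *(1) F] by simp
  thus ?thesis
    unfolding descent_fields_def using ring_iso_image_subfield[OF h *(1)] *(2) by blast
qed

end

section \<open>The core of a uniformly commensurable family\<close>

locale uniformly_commensurable_family = field R for R (structure) +
  fixes \<FF> :: "'a set set" and n :: nat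
  assumes member_subfield: "F \<in> \<FF> \<Longrightarrow> subfield F R"
    and nonempty: "\<FF> \<noteq> {}"
    and uniform_bound: "F \<in> \<FF> \<Longrightarrow> F' \<in> \<FF> \<Longrightarrow> degree_at_most n F (compositum R F F')"
begin

text \<open>Fields of this kind replace the composita of finitely many members: the class contains the members
  and is closed under composita and under automorphisms preserving the family. Containing a member
  bounds the degrees \<open>[CF : C]\<close>, while the last clause bounds the degrees over the members.\<close>

definition bounding :: "'a set \<Rightarrow> bool" where
  "bounding C \<longleftrightarrow> subfield C R \<and> (\<exists>F\<in>\<FF>. F \<subseteq> C) \<and>
     (\<exists>b. \<forall>F\<in>\<FF>. degree_at_most b F (compositum R C F))"

definition generic_degree :: nat where
  "generic_degree = (LEAST m. \<exists>C. bounding C \<and> (\<forall>F\<in>\<FF>. degree_at_most m C (compositum R C F)))"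

definition saturated :: "'a set \<Rightarrow> bool" where
  "saturated C \<longleftrightarrow> bounding C \<and> (\<forall>F\<in>\<FF>. degree_at_most generic_degree C (compositum R C F))"

definition generic :: "'a set \<Rightarrow> 'a set \<Rightarrow> bool" where
  "generic C F \<longleftrightarrow> F \<in> \<FF> \<and> dimension generic_degree C (compositum R C F)"

text \<open>The generators are taken over the generic members only, since for the other members
  the least descent field may change with \<open>C\<close>.\<close>

definition core :: "'a set \<Rightarrow> 'a set" where
  "core C = generate_field R (\<Union>F\<in>{F. generic C F}. descent_base generic_degree C F)"

lemma bounding_subfield: "bounding C \<Longrightarrow> subfield C R"
  unfolding bounding_def by blast

lemma saturated_bounding: "saturated C \<Longrightarrow> bounding C"
  unfolding saturated_def by blast

lemma saturated_subfield: "saturated C \<Longrightarrow> subfield C R"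
  using saturated_bounding bounding_subfield by blast

lemma member_bounding:
  assumes "F \<in> \<FF>"
  shows "bounding F"
  unfolding bounding_def
proof (intro conjI exI ballI)
  show "\<exists>F'\<in>\<FF>. F' \<subseteq> F" using assms by blast
  show "degree_at_most n F' (compositum R F F')" if "F' \<in> \<FF>" for F'
    using uniform_bound[OF that assms] by (simp add: compositum_commute)
qed (rule member_subfield[OF assms])

text \<open>The tower \<open>F, CF, (CF)D\<close> has steps of bounded degree, the second one by base change from \<open>[DF : F]\<close>.\<close>

lemma bounding_compositum:
  assumes "bounding C" "bounding D"
  shows "bounding (compositum R C D)"
proof -
  note C = bounding_subfield[OF assms(1)] and D = bounding_subfield[OF assms(2)]
  obtain c where c: "\<And>F. F \<in> \<FF> \<Longrightarrow> degree_at_most c F (compositum R C F)"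
    using assms(1) unfolding bounding_def by blast
  obtain d where d: "\<And>F. F \<in> \<FF> \<Longrightarrow> degree_at_most d F (compositum R D F)"
    using assms(2) unfolding bounding_def by blast
  have "degree_at_most (c * d) F (compositum R (compositum R C D) F)" if "F \<in> \<FF>" for F
  proof -
    note F = member_subfield[OF that]
    note CF = compositum_subfield[OF C F]
    have "degree_at_most d F (compositum R F D)"
      using d[OF that] by (simp add: compositum_commute)
    hence "degree_at_most d (compositum R C F) (compositum R (compositum R C F) D)"
      by (rule degree_at_most_compositum[OF F CF D compositum_upper(2)])
    hence "degree_at_most (c * d) F (compositum R (compositum R C F) D)"
      by (rule degree_at_most_tower[OF F CF c[OF that]])
    thus ?thesis using compositum_right_commute[OF C D F] by simp
  qed
  moreover obtain F where "F \<in> \<FF>" "F \<subseteq> C" using assms(1) unfolding bounding_def by blast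
  hence "\<exists>F\<in>\<FF>. F \<subseteq> compositum R C D" using subset_trans[OF _ compositum_upper(1)[of C D]] by blast
  ultimately show ?thesis unfolding bounding_def using compositum_subfield[OF C D] by blast
qed

lemma saturated_exists: "\<exists>C. saturated C"
proof -
  let ?P = "\<lambda>m. \<exists>C. bounding C \<and> (\<forall>F\<in>\<FF>. degree_at_most m C (compositum R C F))"
  obtain F where "F \<in> \<FF>" using nonempty by blast
  hence "?P n" using member_bounding uniform_bound by blast
  hence "?P (LEAST m. ?P m)" by (rule LeastI)
  thus ?thesis unfolding saturated_def generic_degree_def .
qed

lemma saturated_mono:
  assumes "saturated C" "bounding C'" "C \<subseteq> C'"
  shows "saturated C'"
  unfolding saturated_def
proof (intro conjI ballI assms(2))
  fix F assume F: "F \<in> \<FF>"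
  hence "degree_at_most generic_degree C (compositum R C F)"
    using assms(1) unfolding saturated_def by blast
  thus "degree_at_most generic_degree C' (compositum R C' F)"
    by (rule degree_at_most_compositum[OF saturated_subfield[OF assms(1)]
          bounding_subfield[OF assms(2)] member_subfield[OF F] assms(3)])
qed

text \<open>Otherwise all degrees over \<open>C\<close> would be smaller than the least possible maximum.\<close>

lemma generic_exists:
  assumes "saturated C"
  shows "\<exists>F. generic C F"
proof (rule ccontr)
  let ?P = "\<lambda>m. \<exists>C. bounding C \<and> (\<forall>F\<in>\<FF>. degree_at_most m C (compositum R C F))"
  assume none: "\<nexists>F. generic C F"
  have less: "\<exists>k<generic_degree. dimension k C (compositum R C F)" if F: "F \<in> \<FF>" for F
  proof -
    have "degree_at_most generic_degree C (compositum R C F)"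
      using assms F unfolding saturated_def by blast
    then obtain k where k: "k \<le> generic_degree" "dimension k C (compositum R C F)"
      unfolding degree_at_most_def by blast
    have "\<not> generic C F" using none by blast
    hence "k \<noteq> generic_degree" using k(2) F unfolding generic_def by metis
    hence "k < generic_degree" using k(1) by linarith
    thus ?thesis using k(2) by (intro exI conjI)
  qed
  obtain F\<^sub>0 where "F\<^sub>0 \<in> \<FF>" using nonempty by blast
  then obtain k where "k < generic_degree" using less by blast
  hence "0 < generic_degree" by simp
  moreover have "degree_at_most (generic_degree - 1) C (compositum R C F)" if F: "F \<in> \<FF>" for F
  proof -
    obtain k where k: "k < generic_degree" "dimension k C (compositum R C F)"
      using less[OF F] by blast
    hence "k \<le> generic_degree - 1" by simp
    thus ?thesis using k(2) unfolding degree_at_most_def by blast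
  qed
  hence "?P (generic_degree - 1)" using saturated_bounding[OF assms] by blast
  hence "(LEAST m. ?P m) \<le> generic_degree - 1" by (rule Least_le)
  hence "generic_degree \<le> generic_degree - 1" by (simp only: generic_degree_def[symmetric])
  ultimately show False by linarith
qed

text \<open>The degree over \<open>C\<close> is at least the one over \<open>C'\<close>, which has the maximal value already.\<close>

lemma generic_antimono:
  assumes "saturated C" "bounding C'" "C \<subseteq> C'" "generic C' F"
  shows "generic C F"
proof -
  note C' = bounding_subfield[OF assms(2)]
  have F: "F \<in> \<FF>" and dim': "dimension generic_degree C' (compositum R C' F)"
    using assms(4) unfolding generic_def by blast+
  obtain k where k: "k \<le> generic_degree" "dimension k C (compositum R C F)"
    using assms(1) F unfolding saturated_def degree_at_most_def by blast
  hence "degree_at_most k C (compositum R C F)" unfolding degree_at_most_def by blast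
  hence "degree_at_most k C' (compositum R C' F)"
    by (rule degree_at_most_compositum[OF saturated_subfield[OF assms(1)] C' member_subfield[OF F] assms(3)])
  hence "generic_degree \<le> k"
    using dimension_is_inj[OF C' dim'] unfolding degree_at_most_def by blast
  thus ?thesis using k F unfolding generic_def by simp
qed

lemma generic_descent_base:
  assumes "subfield C R" "generic C F"
  shows "descent_base generic_degree C F \<in> descent_fields generic_degree C F"
  using assms member_subfield unfolding generic_def by (blast intro: descent_base_is_descent_field)

lemma generic_descent_base_eq:
  assumes "saturated C" "bounding C'" "C \<subseteq> C'" "generic C' F"
  shows "descent_base generic_degree C' F = descent_base generic_degree C F"
  using descent_base_eq[OF saturated_subfield[OF assms(1)] bounding_subfield[OF assms(2)] _ assms(3)]
    generic_antimono[OF assms] assms(4) member_subfield unfolding generic_def by blast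

lemma core_generators_subset:
  assumes "subfield C R"
  shows "(\<Union>F\<in>{F. generic C F}. descent_base generic_degree C F) \<subseteq> C"
  using generic_descent_base[OF assms] unfolding descent_fields_def by blast

lemma core_subfield:
  assumes "subfield C R"
  shows "subfield (core C) R"
  unfolding core_def
  by (rule generate_field_is_subfield)
     (rule subset_trans[OF core_generators_subset[OF assms] subfieldE(3)[OF assms]])

lemma core_least:
  assumes "subfield E R" "\<And>F. generic C F \<Longrightarrow> descent_base generic_degree C F \<subseteq> E"
  shows "core C \<subseteq> E"
  unfolding core_def
proof (rule generate_field_min_subfield1[OF _ assms(1)])
  show "(\<Union>F\<in>{F. generic C F}. descent_base generic_degree C F) \<subseteq> E" using assms(2) by blast
  thus "(\<Union>F\<in>{F. generic C F}. descent_base generic_degree C F) \<subseteq> carrier R"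
    using subfieldE(3)[OF assms(1)] by blast
qed

lemma core_upper:
  assumes "generic C F"
  shows "descent_base generic_degree C F \<subseteq> core C"
  unfolding core_def using assms by (auto intro: generate_field.incl)

lemma core_subset:
  assumes "subfield C R"
  shows "core C \<subseteq> C"
  using core_least[OF assms] core_generators_subset[OF assms] by blast

text \<open>Over a larger field fewer members are generic, and their least descent fields stay the same.\<close>

lemma core_antimono:
  assumes "saturated C" "bounding C'" "C \<subseteq> C'"
  shows "core C' \<subseteq> core C"
proof (rule core_least[OF core_subfield[OF saturated_subfield[OF assms(1)]]])
  fix F assume F: "generic C' F"
  show "descent_base generic_degree C' F \<subseteq> core C"
    using core_upper[OF generic_antimono[OF assms F]] generic_descent_base_eq[OF assms F] by simp
qed

text \<open>The bound \<open>b\<close> depends on \<open>C\<close> only and not on \<open>C'\<close>. This is what makes the decreasing family of cores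
  stabilise. The member \<open>F\<close> is chosen generic over \<open>C'\<close>, and its least descent field can then be computed
  over \<open>C\<close>.\<close>

lemma degree_over_core:
  assumes "saturated C" "bounding C'" "C \<subseteq> C'"
    and deg: "\<And>F. F \<in> \<FF> \<Longrightarrow> degree_at_most b F (compositum R C F)"
  shows "degree_at_most b (core C') C"
proof -
  note C = saturated_subfield[OF assms(1)] and C' = bounding_subfield[OF assms(2)]
  obtain F where F: "generic C' F"
    using generic_exists[OF saturated_mono[OF assms(1-3)]] by blast
  let ?D = "descent_base generic_degree C' F"
  have FC: "generic C F" by (rule generic_antimono[OF assms(1-3) F])
  hence mem: "F \<in> \<FF>" and dim: "dimension generic_degree C (compositum R C F)"
    unfolding generic_def by blast+
  have D: "?D \<in> descent_fields generic_degree C F"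
    using generic_descent_base[OF C FC] generic_descent_base_eq[OF assms(1-3) F] by simp
  hence D_sub: "subfield ?D R" unfolding descent_fields_def by blast
  have "degree_at_most b ?D C"
    by (rule degree_over_descent_field[OF C member_subfield[OF mem] dim D deg[OF mem]])
  moreover have "core C' \<subseteq> C"
    using core_antimono[OF assms(1-3)] core_subset[OF C] by blast
  ultimately show ?thesis
    using degree_at_most_upper[OF D_sub core_subfield[OF C'] C core_upper[OF F]] by blast
qed

text \<open>With a saturated \<open>A\<close> fixed, choose \<open>C\<close> above \<open>A\<close> such that the bounded degree of \<open>A\<close> over the core
  of \<open>C\<close> is as large as possible. A smaller core further up would make this degree larger.\<close>

lemma core_stabilises:
  obtains C where "saturated C" "\<And>C'. bounding C' \<Longrightarrow> C \<subseteq> C' \<Longrightarrow> core C' = core C"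
proof -
  obtain A where A: "saturated A" using saturated_exists by blast
  then obtain b where b: "\<And>F. F \<in> \<FF> \<Longrightarrow> degree_at_most b F (compositum R A F)"
    unfolding saturated_def bounding_def by blast
  define P where "P = (\<lambda>k. \<exists>C. bounding C \<and> A \<subseteq> C \<and> dimension k (core C) A)"
  have P_bound: "\<exists>k\<le>b. dimension k (core C) A" if "bounding C" "A \<subseteq> C" for C
    using degree_over_core[OF A that b] unfolding degree_at_most_def by blast
  have P_le: "\<forall>k. P k \<longrightarrow> k \<le> b"
  proof (intro allI impI)
    fix k assume "P k"
    then obtain C where C: "bounding C" "A \<subseteq> C" "dimension k (core C) A" unfolding P_def by blast
    show "k \<le> b"
      using P_bound[OF C(1,2)] C(3) dimension_is_inj[OF core_subfield[OF bounding_subfield[OF C(1)]]]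
      by blast
  qed
  obtain k0 where "P k0" unfolding P_def using P_bound saturated_bounding[OF A] by blast
  hence "P (Greatest P)" using GreatestI_nat P_le by blast
  then obtain C where C: "bounding C" "A \<subseteq> C" and dim: "dimension (Greatest P) (core C) A"
    unfolding P_def by blast
  have C_sat: "saturated C" by (rule saturated_mono[OF A C])
  have "core C' = core C" if C': "bounding C'" "C \<subseteq> C'" for C'
  proof -
    note core_C' = core_subfield[OF bounding_subfield[OF C'(1)]]
    note core_C = core_subfield[OF bounding_subfield[OF C(1)]]
    have sub: "core C' \<subseteq> core C" by (rule core_antimono[OF C_sat C'])
    have AC': "A \<subseteq> C'" using C(2) C'(2) by blast
    obtain k where k: "dimension k (core C') A" using P_bound[OF C'(1) AC'] by blast
    hence "P k" unfolding P_def using C'(1) AC' by blast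
    hence k_le: "k \<le> Greatest P" using Greatest_le_nat P_le by blast
    have "core C \<subseteq> A" using core_antimono[OF A C] core_subset[OF saturated_subfield[OF A]] by blast
    hence "degree_at_most k (core C') (core C)"
      using degree_at_most_subfield[OF core_C' core_C sub] k unfolding degree_at_most_def by blast
    then obtain j where j: "dimension j (core C') (core C)" unfolding degree_at_most_def by blast
    have "j * Greatest P = k"
      by (rule dimension_is_inj[OF core_C' telescopic_base[OF core_C' core_C j dim] k])
    moreover have "0 < Greatest P" by (rule dimension_pos[OF dim saturated_subfield[OF A]])
    moreover have "0 < j" by (rule dimension_pos[OF j core_C])
    ultimately have "j = 1" using k_le by (cases j) auto
    hence "dimension 1 (core C') (core C)" using j by simp
    thus ?thesis by (rule eq_if_same_dimension[OF core_C' dimension_one[OF core_C'] _ sub])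
  qed
  thus ?thesis using that C_sat by blast
qed

text \<open>The core lies in \<open>C\<close>, which has finite degree over each member. Conversely it contains a least
  descent field, over which a generic member \<open>G\<close> has finite degree, and \<open>F\<close> is reached through \<open>G\<close>.\<close>

lemma core_commensurable:
  assumes C: "saturated C" and F: "F \<in> \<FF>"
  shows "commensurable R (core C) F"
proof -
  note C_sub = saturated_subfield[OF C] and F_sub = member_subfield[OF F]
  note N = core_subfield[OF C_sub]
  note NF = compositum_subfield[OF N F_sub]
  obtain b where "degree_at_most b F (compositum R C F)"
    using C F unfolding saturated_def bounding_def by blast
  hence "degree_at_most b F (compositum R (core C) F)"
    by (rule degree_at_most_subfield[OF F_sub NF compositum_upper(2)
          compositum_mono[OF C_sub F_sub core_subset[OF C_sub]]])
  hence 1: "commensurably_contained R (core C) F"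
    unfolding commensurably_contained_def by (rule degree_at_most_imp_finite)
  obtain G where G: "generic C G" using generic_exists[OF C] by blast
  hence G_mem: "G \<in> \<FF>" unfolding generic_def by blast
  note G_sub = member_subfield[OF G_mem]
  let ?D = "descent_base generic_degree C G"
  have D: "subfield ?D R" "degree_at_most generic_degree ?D (compositum R ?D G)"
    using generic_descent_base[OF C_sub G] unfolding descent_fields_def degree_at_most_def by blast+
  note NG = compositum_subfield[OF N G_sub]
  have "degree_at_most generic_degree (core C) (compositum R (core C) G)"
    by (rule degree_at_most_compositum[OF D(1) N G_sub core_upper[OF G] D(2)])
  moreover have "degree_at_most n (compositum R (core C) G) (compositum R (compositum R (core C) G) F)"
    by (rule degree_at_most_compositum[OF G_sub NG F_sub compositum_upper(2) uniform_bound[OF G_mem F]])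
  ultimately have "degree_at_most (generic_degree * n) (core C) (compositum R (compositum R (core C) G) F)"
    by (rule degree_at_most_tower[OF N NG])
  moreover have "compositum R (core C) F \<subseteq> compositum R (compositum R (core C) G) F"
    by (rule compositum_mono[OF NG F_sub compositum_upper(1)])
  ultimately have "degree_at_most (generic_degree * n) (core C) (compositum R (core C) F)"
    using degree_at_most_subfield[OF N NF compositum_upper(1)] by blast
  hence "commensurably_contained R F (core C)"
    unfolding commensurably_contained_def
    by (simp add: compositum_commute degree_at_most_imp_finite)
  thus ?thesis using 1 unfolding commensurable_def by blast
qed

lemma image_saturated:
  assumes h: "h \<in> ring_iso R R" and inv: "(`) h ` \<FF> = \<FF>" and C: "saturated C"
  shows "saturated (h ` C)"
proof -
  note C_sub = saturated_subfield[OF C]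
  obtain F\<^sub>0 where F\<^sub>0: "F\<^sub>0 \<in> \<FF>" "F\<^sub>0 \<subseteq> C"
    using C unfolding saturated_def bounding_def by blast
  have "h ` F\<^sub>0 \<in> \<FF>" using imageI[OF F\<^sub>0(1), of "(`) h"] unfolding inv .
  moreover have "h ` F\<^sub>0 \<subseteq> h ` C" using F\<^sub>0(2) by (rule image_mono)
  ultimately have 1: "\<exists>F\<in>\<FF>. F \<subseteq> h ` C" by (rule bexI[rotated])
  obtain b where b: "\<And>F. F \<in> \<FF> \<Longrightarrow> degree_at_most b F (compositum R C F)"
    using C unfolding saturated_def bounding_def by blast
  have 2: "degree_at_most b F (compositum R (h ` C) F)" if F: "F \<in> \<FF>" for F
  proof -
    obtain F' where F': "F' \<in> \<FF>" "F = h ` F'" using F inv by blast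
    note F'_sub = member_subfield[OF F'(1)]
    show ?thesis
      unfolding F'(2) by (rule ring_iso_image_degree_at_most[OF h C_sub F'_sub F'_sub b[OF F'(1)]])
  qed
  have 3: "degree_at_most generic_degree (h ` C) (compositum R (h ` C) F)" if F: "F \<in> \<FF>" for F
  proof -
    obtain F' where F': "F' \<in> \<FF>" "F = h ` F'" using F inv by blast
    have deg: "degree_at_most generic_degree C (compositum R C F')"
      using C F'(1) unfolding saturated_def by blast
    show ?thesis
      unfolding F'(2) by (rule ring_iso_image_degree_at_most[OF h C_sub member_subfield[OF F'(1)] C_sub deg])
  qed
  show ?thesis
    unfolding saturated_def bounding_def
    by (intro conjI exI[of _ b] ballI ring_iso_image_subfield[OF h C_sub] 1 2 3)
qed

lemma core_image:
  assumes h: "h \<in> ring_iso R R" and inv: "(`) h ` \<FF> = \<FF>" and C: "saturated C"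
  shows "core (h ` C) \<subseteq> h ` core C"
proof (rule core_least)
  note C_sub = saturated_subfield[OF C]
  show "subfield (h ` core C) R" by (rule ring_iso_image_subfield[OF h core_subfield[OF C_sub]])
  fix F assume F: "generic (h ` C) F"
  then obtain F' where F': "F' \<in> \<FF>" "F = h ` F'" using inv unfolding generic_def by blast
  note F'_sub = member_subfield[OF F'(1)]
  obtain k where k: "dimension k C (compositum R C F')"
    using C F'(1) unfolding saturated_def degree_at_most_def by blast
  hence "dimension k (h ` C) (h ` compositum R C F')"
    by (rule ring_iso_image_dimension[OF h C_sub])
  hence "dimension k (h ` C) (compositum R (h ` C) F)"
    using ring_iso_image_compositum[OF h C_sub F'_sub] F'(2) by simp
  hence "k = generic_degree"
    using dimension_is_inj[OF ring_iso_image_subfield[OF h C_sub]] F unfolding generic_def by blast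
  hence gen: "generic C F'" using k F'(1) unfolding generic_def by blast
  have "h ` descent_base generic_degree C F' \<in> descent_fields generic_degree (h ` C) F"
    using ring_iso_image_descent_field[OF h F'_sub generic_descent_base[OF C_sub gen]] F'(2) by simp
  hence "descent_base generic_degree (h ` C) F \<subseteq> h ` descent_base generic_degree C F'"
    unfolding descent_base_def[of _ "h ` C"] by blast
  thus "descent_base generic_degree (h ` C) F \<subseteq> h ` core C"
    using core_upper[OF gen] by blast
qed

text \<open>A stable core is contained in each of its images under automorphisms preserving the family, and the
  inverse automorphism gives the opposite inclusion.\<close>

theorem invariant_commensurable_subfield:
  shows "\<exists>N. subfield N R \<and> (\<forall>F\<in>\<FF>. commensurable R N F) \<and>
    (\<forall>h\<in>ring_iso R R. (`) h ` \<FF> = \<FF> \<longrightarrow> h ` N = N)"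
proof -
  obtain C where C: "saturated C" and
      stable: "\<And>C'. bounding C' \<Longrightarrow> C \<subseteq> C' \<Longrightarrow> core C' = core C"
    using core_stabilises by blast
  note N = core_subfield[OF saturated_subfield[OF C]]
  have grows: "core C \<subseteq> h ` core C" if h: "h \<in> ring_iso R R" "(`) h ` \<FF> = \<FF>" for h
  proof -
    have hC: "saturated (h ` C)" by (rule image_saturated[OF h C])
    let ?D = "compositum R C (h ` C)"
    have D: "bounding ?D"
      by (rule bounding_compositum[OF saturated_bounding[OF C] saturated_bounding[OF hC]])
    have "core C = core ?D" using stable[OF D compositum_upper(1)] by simp
    also have "\<dots> \<subseteq> core (h ` C)" by (rule core_antimono[OF hC D compositum_upper(2)])
    also have "\<dots> \<subseteq> h ` core C" by (rule core_image[OF h C])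
    finally show ?thesis .
  qed
  have "h ` core C = core C" if h: "h \<in> ring_iso R R" and inv: "(`) h ` \<FF> = \<FF>" for h
  proof
    let ?g = "inv_into (carrier R) h"
    have cancel: "?g ` h ` F = F" if "F \<in> \<FF>" for F
      by (rule ring_iso_inverse(2)[OF h subfieldE(3)[OF member_subfield[OF that]]])
    have "(`) ?g ` \<FF> = (\<lambda>F. ?g ` h ` F) ` \<FF>"
      by (subst inv[symmetric]) (simp add: image_image)
    hence "(`) ?g ` \<FF> = \<FF>" using cancel by simp
    hence "h ` core C \<subseteq> h ` ?g ` core C"
      by (intro image_mono grows ring_iso_inverse(1)[OF h])
    thus "h ` core C \<subseteq> core C" using ring_iso_inverse(3)[OF h subfieldE(3)[OF N]] by simp
  qed (rule grows[OF h inv])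
  thus ?thesis using N core_commensurable[OF C] by blast
qed

end

section \<open>Groups of automorphisms\<close>

lemma automorphism_group_image_family:
  assumes "automorphism_group K \<Gamma>" "invariant_family \<Gamma> \<FF>" "\<gamma> \<in> \<Gamma>"
    and "\<And>F. F \<in> \<FF> \<Longrightarrow> F \<subseteq> carrier K"
  shows "(`) \<gamma> ` \<FF> = \<FF>"
proof
  show "(`) \<gamma> ` \<FF> \<subseteq> \<FF>" using assms(2,3) unfolding invariant_family_def by blast
  show "\<FF> \<subseteq> (`) \<gamma> ` \<FF>"
  proof
    fix F assume F: "F \<in> \<FF>"
    \<comment> \<open>The inverse in the group is the restriction of the set-theoretic inverse to the carrier.\<close>
    let ?\<delta> = "inv\<^bsub>BijGroup (carrier K)\<^esub> \<gamma>"
    have sub: "subgroup \<Gamma> (BijGroup (carrier K))"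
      using assms(1) unfolding automorphism_group_def by blast
    have \<gamma>: "\<gamma> \<in> Bij (carrier K)" using subgroup.subset[OF sub] assms(3) unfolding BijGroup_def by auto
    hence surj: "\<gamma> ` carrier K = carrier K" unfolding Bij_def bij_betw_def by blast
    have "?\<delta> ` F = inv_into (carrier K) \<gamma> ` F"
      using inv_BijGroup[OF \<gamma>] assms(4)[OF F] by (auto simp: subset_iff)
    hence eq: "\<gamma> ` ?\<delta> ` F = F" using image_inv_into_cancel[OF surj assms(4)[OF F]] by simp
    have "?\<delta> ` F \<in> \<FF>"
      using subgroup.m_inv_closed[OF sub assms(3)] assms(2) F unfolding invariant_family_def by blast
    hence "\<gamma> ` ?\<delta> ` F \<in> (`) \<gamma> ` \<FF>" by (rule imageI)
    thus "F \<in> (`) \<gamma> ` \<FF>" unfolding eq .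
  qed
qed

text \<open>Every member of the group permutes the family, so the invariant subfield of the family is invariant
  under the group. For the empty family the field itself serves.\<close>

theorem theorem3p1:
  fixes K :: "('a, 'b) ring_scheme"
    and \<Gamma> :: "('a \<Rightarrow> 'a) set"
    and \<FF> :: "'a set set"
  assumes "field K"
    and "automorphism_group K \<Gamma>"
    and "\<forall>F\<in>\<FF>. subfield F K"
    and "invariant_family \<Gamma> \<FF>"
    and "uniformly_commensurable K \<FF>"
    and "(\<forall>F\<in>\<FF>. \<forall>F'\<in>\<FF>. separable_extension K F (compositum K F F')) \<or>
         (\<exists>p>0. characteristic K = p \<and>
            (\<forall>F\<in>\<FF>. ring.finite_dimension K (power_image K p F) F))"
  shows "\<exists>N. subfield N K \<and> invariant_set \<Gamma> N \<and> (\<forall>F\<in>\<FF>. commensurable K N F)"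
proof (cases "\<FF> = {}")
  case True
  have "\<gamma> ` carrier K = carrier K" if "\<gamma> \<in> \<Gamma>" for \<gamma>
    using that assms(2) ring_iso_memE(5)[of \<gamma> K K]
    unfolding automorphism_group_def bij_betw_def by blast
  thus ?thesis
    using True field.carrier_is_subfield[OF assms(1)] unfolding invariant_set_def by blast
next
  case False
  interpret field K by (rule assms(1))
  obtain n where n: "\<And>F F'. F \<in> \<FF> \<Longrightarrow> F' \<in> \<FF> \<Longrightarrow>
      finite_dimension F (compositum K F F') \<and> dim F (compositum K F F') \<le> n"
    using assms(5) unfolding uniformly_commensurable_def by blast
  have bound: "degree_at_most n F (compositum K F F')" if FF': "F \<in> \<FF>" "F' \<in> \<FF>" for F F'
  proof -
    have "dimension (dim F (compositum K F F')) F (compositum K F F')"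
      using finite_dimensionE[of F "compositum K F F'"] assms(3) n[OF FF'] FF'(1)
      unfolding over_def by simp
    thus ?thesis using n[OF FF'] unfolding degree_at_most_def by blast
  qed
  interpret uniformly_commensurable_family K \<FF> n
  proof (intro uniformly_commensurable_family.intro uniformly_commensurable_family_axioms.intro)
    show "subfield F K" if "F \<in> \<FF>" for F using assms(3) that by blast
  qed (rule field_axioms False bound; assumption?)+
  obtain N where N: "subfield N K" "\<forall>F\<in>\<FF>. commensurable K N F"
      "\<forall>h\<in>ring_iso K K. (`) h ` \<FF> = \<FF> \<longrightarrow> h ` N = N"
    using invariant_commensurable_subfield by blast
  have "invariant_set \<Gamma> N"
    unfolding invariant_set_def
  proof
    fix \<gamma> assume \<gamma>: "\<gamma> \<in> \<Gamma>"
    have "(`) \<gamma> ` \<FF> = \<FF>"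
      by (rule automorphism_group_image_family[OF assms(2,4) \<gamma> subfieldE(3)[OF member_subfield]])
    thus "\<gamma> ` N = N" using N(3) \<gamma> assms(2) unfolding automorphism_group_def by blast
  qed
  thus ?thesis using N(1,2) by blast
qed

end
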